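(* Let $P=\frac12P_1+\frac12P_2$, where $P_1$ and $P_2$ are the uniform probability distributions on $[0,1]$ and $[\frac12,\frac32]$, respectively. The optimal set of two-means for $P$ is $\{\frac7{16},\frac{17}{16}\}$, with quantization error $V_2(P)=\frac{37}{768}$.
   Context: For a Borel probability measure $P$ on $\mathbb{R}$ and a nonempty finite $\alpha\subset\mathbb{R}$, put $V(P;\alpha)=\int\min_{a\in\alpha}(x-a)^2\,dP(x)$. The $n$th quantization error is $V_n(P)=\inf\{V(P;\alpha):\alpha\subset\mathbb{R},\ 1\le\mathrm{card}(\alpha)\le n\}$, and an optimal set of $n$-means is a set $\alpha$ with $1\le\mathrm{card}(\alpha)\le n$ and $V(P;\alpha)=V_n(P)$. The measure $P$ here has density $\frac12$ on $[0,\frac12]\cup[1,\frac32]$, $1$ on $[\frac12,1]$, and $0$ elsewhere. *)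

theory Defs
  imports "HOL-Probability.Probability"
begin

text \<open>The integrand is nonnegative, so the distortion error is taken in \<^typ>\<open>ennreal\<close>; it is then
  also correct (infinite) for measures without a second moment. It is meaningful only for finite
  nonempty \<^term>\<open>\<alpha>\<close>.\<close>

definition distortion :: "real measure \<Rightarrow> real set \<Rightarrow> ennreal" where
  "distortion P \<alpha> = (\<integral>\<^sup>+ x. ennreal (MIN a\<in>\<alpha>. (x - a)\<^sup>2) \<partial>P)"

text \<open>Since infinite sets have cardinality 0, the bound \<^term>\<open>1 \<le> card \<alpha>\<close> says that \<^term>\<open>\<alpha>\<close> is
  finite and nonempty.\<close>

definition quantization_error :: "nat \<Rightarrow> real measure \<Rightarrow> ennreal" where
  "quantization_error n P = (INF \<alpha>\<in>{\<alpha>. 1 \<le> card \<alpha> \<and> card \<alpha> \<le> n}. distortion P \<alpha>)"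

definition optimal_set_of_means :: "nat \<Rightarrow> real measure \<Rightarrow> real set \<Rightarrow> bool" where
  "optimal_set_of_means n P \<alpha> \<longleftrightarrow>
     1 \<le> card \<alpha> \<and> card \<alpha> \<le> n \<and> distortion P \<alpha> = quantization_error n P"

definition P\<^sub>1 :: "real measure" where
  "P\<^sub>1 = uniform_measure lborel {0..1}"

definition P\<^sub>2 :: "real measure" where
  "P\<^sub>2 = uniform_measure lborel {1/2..3/2}"

text \<open>\<^const>\<open>measure_of\<close> silently yields the zero measure when the given set function is not a
  measure; \<open>emeasure_mixed_uniform\<close> below shows that this does not happen here.\<close>

definition mixed_uniform :: "real measure" where
  "mixed_uniform =
     measure_of UNIV (sets borel) (\<lambda>A. 1/2 * emeasure P\<^sub>1 A + 1/2 * emeasure P\<^sub>2 A)"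

lemma sets_mixed_uniform [simp, measurable_cong]: "sets mixed_uniform = sets borel"
  unfolding mixed_uniform_def
  by (metis sets.sets_measure_of_eq space_borel)

lemma space_mixed_uniform [simp]: "space mixed_uniform = UNIV"
  by (simp add: mixed_uniform_def space_measure_of_conv)

lemma sets_P12 [simp, measurable_cong]: "sets P\<^sub>1 = sets borel" "sets P\<^sub>2 = sets borel"
  by (simp_all add: P\<^sub>1_def P\<^sub>2_def)

lemma emeasure_mixed_uniform:
  assumes "A \<in> sets borel"
  shows "emeasure mixed_uniform A = 1/2 * emeasure P\<^sub>1 A + 1/2 * emeasure P\<^sub>2 A"
proof (rule emeasure_measure_of[OF mixed_uniform_def])
  show "countably_additive (sets mixed_uniform)
          (\<lambda>A. 1/2 * emeasure P\<^sub>1 A + 1/2 * emeasure P\<^sub>2 A)"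
  proof (rule countably_additiveI)
    fix F :: "nat \<Rightarrow> real set"
    assume F: "range F \<subseteq> sets mixed_uniform" "disjoint_family F"
    have "(\<Sum>i. 1/2 * emeasure P\<^sub>1 (F i) + 1/2 * emeasure P\<^sub>2 (F i)) =
          1/2 * (\<Sum>i. emeasure P\<^sub>1 (F i)) + 1/2 * (\<Sum>i. emeasure P\<^sub>2 (F i))"
      by (simp add: suminf_add[symmetric])
    also have "\<dots> = 1/2 * emeasure P\<^sub>1 (\<Union>i. F i) + 1/2 * emeasure P\<^sub>2 (\<Union>i. F i)"
      using F by (simp add: suminf_emeasure)
    finally show "(\<Sum>i. 1/2 * emeasure P\<^sub>1 (F i) + 1/2 * emeasure P\<^sub>2 (F i)) =
        1/2 * emeasure P\<^sub>1 (\<Union>i. F i) + 1/2 * emeasure P\<^sub>2 (\<Union>i. F i)" .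
  qed
qed (use assms in \<open>auto simp: positive_def\<close>)

lemma mixed_uniform_eq_density:
  "mixed_uniform =
     density lborel (\<lambda>x. 1/2 * indicator {0..1} x + 1/2 * indicator {1/2..3/2} x)"
proof (rule measure_eqI)
  fix A assume "A \<in> sets mixed_uniform"
  then have A [measurable]: "A \<in> sets borel" by simp
  have *: "(1/2 * indicator {0..1} x + 1/2 * indicator {1/2..3/2} x) * indicator A x =
        1/2 * indicator ({0..1} \<inter> A) x + (1/2 * indicator ({1/2..3/2} \<inter> A) x :: ennreal)"
    for x :: real
    by (auto simp: indicator_def)
  show "emeasure mixed_uniform A = emeasure (density lborel
          (\<lambda>x. 1/2 * indicator {0..1} x + 1/2 * indicator {1/2..3/2} x)) A"
    by (simp add: emeasure_mixed_uniform emeasure_density * nn_integral_add nn_integral_cmult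
        P\<^sub>1_def P\<^sub>2_def divide_ennreal_def[of _ 1])
qed simp

lemma prob_space_mixed_uniform: "prob_space mixed_uniform"
proof
  have "emeasure P\<^sub>1 UNIV = 1" "emeasure P\<^sub>2 UNIV = 1"
    by (simp_all add: P\<^sub>1_def P\<^sub>2_def)
  moreover have "1/2 + 1/2 = (1 :: ennreal)"
    by (simp add: add_divide_distrib_ennreal[symmetric])
  ultimately show "emeasure mixed_uniform (space mixed_uniform) = 1"
    by (simp add: emeasure_mixed_uniform)
qed

end

theory Submission
  imports Defs
begin

text \<open>
  A set of one or two points can be written as \<open>{c - h, c + h}\<close> with \<open>h \<ge> 0\<close>, and the squared
  distance from \<open>x\<close> to the nearer of these points is \<open>(\<bar>x - c\<bar> - h)\<^sup>2\<close>. For a random variable \<open>X\<close>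
  with the mixed uniform distribution, whose mean is \<open>3/4\<close> and whose variance is \<open>7/48\<close>, expanding
  this square gives, with \<open>A(c) = E \<bar>X - c\<bar>\<close>,

  \<open>V(c, h) = E (X - c)\<^sup>2 - 2 h A(c) + h\<^sup>2 = 7/48 + (c - 3/4)\<^sup>2 - A(c)\<^sup>2 + (h - A(c))\<^sup>2\<close>.

  So the best half-distance for a given midpoint \<open>c\<close> is \<open>h = A(c)\<close>, and what remains is to minimise
  \<open>(c - 3/4)\<^sup>2 - A(c)\<^sup>2\<close>, a problem in one variable. The mean absolute deviation \<open>A\<close> is an explicit
  piecewise quadratic function with \<open>A(3/4) = 5/16\<close>. For \<open>c \<noteq> 3/4\<close> the increase of \<open>A(c)\<^sup>2\<close> over
  \<open>25/256\<close> is strictly smaller than \<open>(c - 3/4)\<^sup>2\<close> (lemma \<open>mean_abs_dev_square_less\<close>). Hence the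
  minimum \<open>7/48 - 25/256 = 37/768\<close> is attained only at \<open>c = 3/4\<close>, \<open>h = 5/16\<close>, which is the pair
  \<open>{7/16, 17/16}\<close>.
\<close>

lemma Min_square_dist_pair:
  fixes x c h :: real
  assumes "h \<ge> 0"
  shows "(MIN a\<in>{c - h, c + h}. (x - a)\<^sup>2) = (\<bar>x - c\<bar> - h)\<^sup>2"
proof -
  have eq: "(x - (c - h))\<^sup>2 = (x - c)\<^sup>2 + 2 * h * (x - c) + h\<^sup>2"
    "(x - (c + h))\<^sup>2 = (x - c)\<^sup>2 - 2 * h * (x - c) + h\<^sup>2"
    "(\<bar>x - c\<bar> - h)\<^sup>2 = (x - c)\<^sup>2 - 2 * h * \<bar>x - c\<bar> + h\<^sup>2"
    by (simp_all add: power2_eq_square algebra_simps abs_if)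
  show ?thesis
  proof (cases "x \<ge> c")
    case True
    then have "h * (x - c) \<ge> 0" using assms by simp
    then have "(MIN a\<in>{c - h, c + h}. (x - a)\<^sup>2) = (x - c)\<^sup>2 - 2 * h * (x - c) + h\<^sup>2"
      by (simp add: eq min_def)
    with True eq(3) show ?thesis by simp
  next
    case False
    then have "h * (x - c) \<le> 0" using assms by (simp add: mult_nonneg_nonpos)
    then have "(MIN a\<in>{c - h, c + h}. (x - a)\<^sup>2) = (x - c)\<^sup>2 + 2 * h * (x - c) + h\<^sup>2"
      by (simp add: eq min_def)
    also have "\<dots> = (x - c)\<^sup>2 - 2 * h * \<bar>x - c\<bar> + h\<^sup>2"
      using False by (simp add: abs_if algebra_simps)
    finally show ?thesis by (simp only: eq(3))
  qed
qed

lemma DERIV_times_abs: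
  fixes t :: real
  shows "((\<lambda>t. t * \<bar>t\<bar>) has_real_derivative 2 * \<bar>t\<bar>) (at t)"
proof (cases "t = 0")
  case True
  have "((\<lambda>h::real. \<bar>h\<bar>) \<longlongrightarrow> 0) (at 0)"
    by (rule tendsto_eq_intros refl tendsto_ident_at)+ simp
  then have "((\<lambda>h::real. (h * \<bar>h\<bar>) / h) \<longlongrightarrow> 0) (at 0)"
    by (rule Lim_transform_eventually) (auto simp: eventually_at_filter)
  with True show ?thesis by (simp add: DERIV_def)
next
  case False
  have "((\<lambda>x. sgn t * x\<^sup>2) has_real_derivative 2 * \<bar>t\<bar>) (at t)"
    by (auto intro!: derivative_eq_intros simp: abs_sgn)
  then show ?thesis
  proof (rule has_field_derivative_transform_within_open[where S = "{x. t * x > 0}"])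
    show "open {x. t * x > 0}" by (intro open_Collect_less continuous_intros)
    show "t \<in> {x. t * x > 0}" using False by (auto simp: zero_less_mult_iff)
    show "sgn t * x\<^sup>2 = x * \<bar>x\<bar>" if "x \<in> {x. t * x > 0}" for x
      using that by (auto simp: zero_less_mult_iff power2_eq_square)
  qed
qed

text \<open>The integrand is \<open>(x - c)\<^sup>2 - 2 h \<bar>x - c\<bar> + h\<^sup>2\<close>, and \<open>t \<bar>t\<bar> / 2\<close> is an antiderivative of
  \<open>\<bar>t\<bar>\<close>; so one closed formula covers every position of \<open>c\<close> relative to the interval.\<close>

lemma nn_integral_square_abs_diff:
  fixes a b c h :: real
  assumes "a \<le> b"
  defines "I \<equiv> ((b - c)^3 - (a - c)^3) / 3
      - h * ((b - c) * \<bar>b - c\<bar> - (a - c) * \<bar>a - c\<bar>) + h\<^sup>2 * (b - a)"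
  shows "(\<integral>\<^sup>+x. ennreal ((\<bar>x - c\<bar> - h)\<^sup>2) * indicator {a..b} x \<partial>lborel) = ennreal I"
    and "I \<ge> 0"
proof -
  define F where "F x = (x - c)^3 / 3 - h * ((x - c) * \<bar>x - c\<bar>) + h\<^sup>2 * x" for x
  have F': "(F has_real_derivative (\<bar>x - c\<bar> - h)\<^sup>2) (at x)" for x
  proof -
    have "((\<lambda>x. x - c) has_real_derivative 1) (at x)"
      by (auto intro!: derivative_eq_intros)
    then have [derivative_intros]:
      "((\<lambda>x. (x - c) * \<bar>x - c\<bar>) has_real_derivative 2 * \<bar>x - c\<bar>) (at x)"
      using DERIV_chain2[OF DERIV_times_abs] by fastforce
    have "(F has_real_derivative (x - c)\<^sup>2 - h * (2 * \<bar>x - c\<bar>) + h\<^sup>2) (at x)"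
      unfolding F_def
      by (rule derivative_eq_intros refl | simp)+
    then show ?thesis
      by (simp add: power2_diff algebra_simps)
  qed
  have I: "I = F b - F a"
    by (simp add: I_def F_def algebra_simps diff_divide_distrib)
  show "I \<ge> 0"
    unfolding I using DERIV_nonneg_imp_nondecreasing[OF \<open>a \<le> b\<close>, of F] F'
    by (metis diff_ge_0_iff_ge zero_le_power2)
  show "(\<integral>\<^sup>+x. ennreal ((\<bar>x - c\<bar> - h)\<^sup>2) * indicator {a..b} x \<partial>lborel) = ennreal I"
    unfolding I using assms(1) F' by (intro nn_integral_FTC_Icc) (auto intro: DERIV_subset)
qed

lemma nn_integral_mixed_uniform:
  assumes [measurable]: "f \<in> borel_measurable borel"
  shows "(\<integral>\<^sup>+x. f x \<partial>mixed_uniform) =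
    1/2 * (\<integral>\<^sup>+x. f x * indicator {0..1} x \<partial>lborel) +
    1/2 * (\<integral>\<^sup>+x. f x * indicator {1/2..3/2} x \<partial>lborel)"
proof -
  have "(\<integral>\<^sup>+x. f x \<partial>mixed_uniform) =
      (\<integral>\<^sup>+x. 1/2 * (f x * indicator {0..1} x) + 1/2 * (f x * indicator {1/2..3/2} x) \<partial>lborel)"
    unfolding mixed_uniform_eq_density
    by (subst nn_integral_density) (auto simp: algebra_simps)
  then show ?thesis
    by (simp add: nn_integral_add nn_integral_cmult)
qed

text \<open>The mean absolute deviation of the mixed uniform distribution from the point \<open>3/4 + d\<close>. The
  form is that of the antiderivative \<open>t \<bar>t\<bar> / 2\<close>, evaluated at the two ends of each of the two
  intervals.\<close>

definition mean_abs_dev :: "real \<Rightarrow> real" where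
  "mean_abs_dev d = ((3/4 + d) * \<bar>3/4 + d\<bar> + (3/4 - d) * \<bar>3/4 - d\<bar> +
    (1/4 + d) * \<bar>1/4 + d\<bar> + (1/4 - d) * \<bar>1/4 - d\<bar>) / 4"

text \<open>The right-hand side completes the square in \<open>h\<close>, which separates the half-distance \<open>h\<close> from
  the midpoint \<open>3/4 + d\<close>.\<close>

lemma distortion_mixed_uniform_pair:
  assumes "h \<ge> 0"
  shows "distortion mixed_uniform {3/4 + d - h, 3/4 + d + h} =
    ennreal (7/48 + d\<^sup>2 - (mean_abs_dev d)\<^sup>2 + (h - mean_abs_dev d)\<^sup>2)"
proof -
  define I where "I a b = ((b - (3/4 + d))^3 - (a - (3/4 + d))^3) / 3
      - h * ((b - (3/4 + d)) * \<bar>b - (3/4 + d)\<bar> - (a - (3/4 + d)) * \<bar>a - (3/4 + d)\<bar>)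
      + h\<^sup>2 * (b - a)" for a b
  have "1/2 = ennreal (1/2)"
    using divide_ennreal[of 1 2] by simp
  then have half: "1/2 * ennreal r = ennreal (1/2 * r)" for r
    by (simp only: ennreal_mult')
  have I_nonneg: "I a b \<ge> 0" if "a \<le> b" for a b
    unfolding I_def by (rule nn_integral_square_abs_diff(2)[OF that])
  have "distortion mixed_uniform {3/4 + d - h, 3/4 + d + h} =
      (\<integral>\<^sup>+x. ennreal ((\<bar>x - (3/4 + d)\<bar> - h)\<^sup>2) \<partial>mixed_uniform)"
    unfolding distortion_def using Min_square_dist_pair[OF assms, of _ "3/4 + d"] by simp
  also have "\<dots> = ennreal (1/2 * I 0 1) + ennreal (1/2 * I (1/2) (3/2))"
    by (simp add: nn_integral_mixed_uniform nn_integral_square_abs_diff(1) I_def half)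
  also have "\<dots> = ennreal (1/2 * I 0 1 + 1/2 * I (1/2) (3/2))"
    by (intro ennreal_plus[symmetric]) (simp_all add: I_nonneg)
  also have "1/2 * I 0 1 + 1/2 * I (1/2) (3/2) =
      7/48 + d\<^sup>2 - (mean_abs_dev d)\<^sup>2 + (h - mean_abs_dev d)\<^sup>2"
  proof -
    have flip: "0 - (3/4 + d) = - (3/4 + d)" "1 - (3/4 + d) = 1/4 - d"
      "1/2 - (3/4 + d) = - (1/4 + d)" "3/2 - (3/4 + d) = 3/4 - d"
      by simp_all
    have "1/2 * I 0 1 + 1/2 * I (1/2) (3/2) = 7/48 + d\<^sup>2 + h\<^sup>2 - 2 * h * mean_abs_dev d"
      unfolding I_def flip abs_minus_cancel
      by (simp add: mean_abs_dev_def power2_eq_square power3_eq_cube field_simps)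
    then show ?thesis by (simp add: power2_diff)
  qed
  finally show ?thesis .
qed

text \<open>At \<open>d = 0\<close> both sides are \<open>25/256\<close>, and the deviation is even in \<open>d\<close>. For
  \<open>\<bar>d\<bar> \<le> 1/4\<close> it equals \<open>5/16 + d\<^sup>2\<close>, whose square grows only like \<open>5/8 d\<^sup>2\<close> near \<open>0\<close>. For
  \<open>1/4 \<le> \<bar>d\<bar> \<le> 3/4\<close> it is convex in \<open>\<bar>d\<bar>\<close> and therefore below the chord \<open>3/16 + 3 \<bar>d\<bar> / 4\<close>.
  Once the point is outside the support, all mass lies on one side of it and the deviation is
  \<open>\<bar>d\<bar>\<close>, the distance to the mean.\<close>

lemma mean_abs_dev_square_less:
  assumes "d \<noteq> 0"
  shows "(mean_abs_dev d)\<^sup>2 < 25/256 + d\<^sup>2"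
proof -
  define e where "e = \<bar>d\<bar>"
  have "e > 0" and sq: "e\<^sup>2 = d\<^sup>2" using assms by (auto simp: e_def)
  have even: "mean_abs_dev d = mean_abs_dev e"
    by (auto simp: e_def mean_abs_dev_def abs_if)
  consider "e \<le> 1/4" | "1/4 < e" "e \<le> 3/4" | "3/4 < e" by linarith
  then have "(mean_abs_dev e)\<^sup>2 < 25/256 + e\<^sup>2"
  proof cases
    case 1
    have "mean_abs_dev e = 5/16 + e\<^sup>2"
      using 1 \<open>e > 0\<close> by (simp add: mean_abs_dev_def power2_eq_square field_simps)
    moreover have "e\<^sup>2 * e\<^sup>2 < e\<^sup>2 * (3/8)"
      using 1 \<open>e > 0\<close> power_mono[of e "1/4" 2]
      by (intro mult_strict_left_mono) (auto simp: power2_eq_square)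
    ultimately show ?thesis
      by (simp add: power2_sum power2_eq_square[of "e\<^sup>2"] power2_eq_square[of "5/16::real"])
  next
    case 2
    have "mean_abs_dev e = (3/16 + 3/4 * e) + (e - 1/4) * (e - 3/4) / 2"
      using 2 by (simp add: mean_abs_dev_def field_simps)
    moreover have "(e - 1/4) * (e - 3/4) \<le> 0"
      using 2 by (intro mult_nonneg_nonpos) auto
    ultimately have "mean_abs_dev e \<le> 3/16 + 3/4 * e" by simp
    moreover have "mean_abs_dev e \<ge> 0"
      using 2 by (simp add: mean_abs_dev_def field_simps)
    ultimately have "(mean_abs_dev e)\<^sup>2 \<le> (3/16 + 3/4 * e)\<^sup>2"
      by (intro power_mono)
    \<comment> \<open>The difference of the two sides is a quadratic in \<open>e\<close> with negative discriminant and
      vertex \<open>9/28\<close>.\<close>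
    also have "\<dots> < 25/256 + e\<^sup>2"
      using zero_le_power2[of "e - 9/28"] by (simp add: power2_eq_square field_simps)
    finally show ?thesis .
  next
    case 3
    then have "mean_abs_dev e = e"
      by (simp add: mean_abs_dev_def field_simps)
    then show ?thesis by simp
  qed
  then show ?thesis by (simp add: even sq)
qed

lemma card_one_or_two_midpoint_form:
  fixes \<alpha> :: "real set"
  assumes "1 \<le> card \<alpha>" "card \<alpha> \<le> 2"
  obtains d h where "h \<ge> 0" "\<alpha> = {m + d - h, m + d + h}"
proof -
  have "card \<alpha> = 1 \<or> card \<alpha> = 2" using assms by linarith
  then obtain a b where ab: "\<alpha> = {a, b}" "a \<le> b"
    by (metis card_1_singletonE card_2_iff doubleton_eq_iff insert_absorb2 linear)
  show ?thesis
    by (rule that[of "(b - a) / 2" "(a + b) / 2 - m"]) (use ab in \<open>auto simp: field_simps\<close>)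
qed

text \<open>The two nonnegative excess terms over \<open>37/768 = 7/48 - 25/256\<close>, one for the midpoint and one
  for the half-distance, vanish together only at \<open>d = 0\<close>, \<open>h = 5/16\<close>.\<close>

lemma distortion_mixed_uniform_lower_bound:
  assumes "1 \<le> card \<alpha>" "card \<alpha> \<le> 2"
  shows "distortion mixed_uniform \<alpha> \<ge> ennreal (37/768)"
    and "distortion mixed_uniform \<alpha> = ennreal (37/768) \<longleftrightarrow> \<alpha> = {7/16, 17/16}"
proof -
  obtain d h where h: "h \<ge> 0" and \<alpha>: "\<alpha> = {3/4 + d - h, 3/4 + d + h}"
    using card_one_or_two_midpoint_form[OF assms] by blast
  define V where "V = 7/48 + d\<^sup>2 - (mean_abs_dev d)\<^sup>2 + (h - mean_abs_dev d)\<^sup>2"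
  have dist: "distortion mixed_uniform \<alpha> = ennreal V"
    using distortion_mixed_uniform_pair[OF h, of d] by (simp add: \<alpha> V_def)
  have zero: "mean_abs_dev 0 = 5/16"
    by (simp add: mean_abs_dev_def)
  have V0: "V = 37/768 + (h - 5/16)\<^sup>2" if "d = 0"
    by (simp add: V_def that zero power2_eq_square)
  have V1: "V > 37/768" if "d \<noteq> 0"
    using mean_abs_dev_square_less[OF that] zero_le_power2[of "h - mean_abs_dev d"]
    unfolding V_def by linarith
  have ge: "V \<ge> 37/768"
    using V0 V1 by (cases "d = 0") auto
  then show "distortion mixed_uniform \<alpha> \<ge> ennreal (37/768)"
    by (simp add: dist)
  have "distortion mixed_uniform \<alpha> = ennreal (37/768) \<longleftrightarrow> V = 37/768"
    using ge by (simp add: dist)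
  also have "\<dots> \<longleftrightarrow> d = 0 \<and> h = 5/16"
    using V0 V1 by (cases "d = 0") auto
  also have "\<dots> \<longleftrightarrow> \<alpha> = {7/16, 17/16}"
    using h by (auto simp: \<alpha> doubleton_eq_iff)
  finally show "distortion mixed_uniform \<alpha> = ennreal (37/768) \<longleftrightarrow> \<alpha> = {7/16, 17/16}" .
qed

theorem proposition3p2:
  shows "(\<forall>\<alpha>. optimal_set_of_means 2 mixed_uniform \<alpha> \<longleftrightarrow> \<alpha> = {7/16, 17/16}) \<and>
    quantization_error 2 mixed_uniform = ennreal (37/768)"
proof -
  have card: "card {7/16, 17/16::real} = 2" by simp
  then have dist: "distortion mixed_uniform {7/16, 17/16} = ennreal (37/768)"
    by (subst distortion_mixed_uniform_lower_bound(2)) auto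
  have V2: "quantization_error 2 mixed_uniform = ennreal (37/768)"
    unfolding quantization_error_def
  proof (rule antisym)
    show "(INF \<alpha>\<in>{\<alpha>. 1 \<le> card \<alpha> \<and> card \<alpha> \<le> 2}. distortion mixed_uniform \<alpha>) \<le> ennreal (37/768)"
      using card dist by (intro INF_lower2[of "{7/16, 17/16}"]) auto
    show "ennreal (37/768) \<le> (INF \<alpha>\<in>{\<alpha>. 1 \<le> card \<alpha> \<and> card \<alpha> \<le> 2}. distortion mixed_uniform \<alpha>)"
      by (intro INF_greatest) (auto intro!: distortion_mixed_uniform_lower_bound(1))
  qed
  have "optimal_set_of_means 2 mixed_uniform \<alpha> \<longleftrightarrow> \<alpha> = {7/16, 17/16}" for \<alpha>
    using distortion_mixed_uniform_lower_bound(2)[of \<alpha>] card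
    unfolding optimal_set_of_means_def V2 by auto
  with V2 show ?thesis by blast
qed

end
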